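(* Let $(\Omega,\Sigma,\mathbb{P})$ be a probability space and let $b(s)=s^{\alpha}L_b(s)$ be a normalizing function with index $\alpha$. For $X\in\mathbb{V}_b$ define $$\|X\|_b=\kappa_X^{1/\alpha}=\Big\{\lim_{s\to\infty} b(s)\mathbb{P}(|X|>s)\Big\}^{1/\alpha}.$$ If $\alpha>1$, then $\|\cdot\|_b$ defines a seminorm on $\mathbb{V}_b$.
   Context: A measurable function $L:(0,\infty)\to(0,\infty)$ is slowly varying if $\lim_{s\to\infty} L(sx)/L(s)=1$ for all $x>0$. A normalizing function with index $\alpha>0$ is a function $b(s)=s^{\alpha}L(s)$ with $L$ slowly varying. Let $L^0(\Omega,\Sigma,\mathbb{P})$ be the collection of all real-valued random variables on $\Omega$. Define $$\mathbb{V}_b=\Big\{X\in L^0(\Omega,\Sigma,\mathbb{P}) : \forall x>0,\ \lim_{s\to\infty} b(s)\mathbb{P}(X>sx)<\infty \text{ and } \lim_{s\to\infty} b(s)\mathbb{P}(X<-sx)<\infty\Big\},$$ i.e. for every $x>0$ both limits exist and are finite, with the usual addition and scalar multiplication of random variables. The quantity $\kappa_X=\lim_{s\to\infty} b(s)\mathbb{P}(|X|>s)$ is the $\alpha$-scale of $X$ when normalized by $b$.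
   Formalization: V_b need not be closed under addition, so the norm of X+Y may be undefined; the seminorm property is stated as 0 in V_b, closure under scalars, nonnegativity, absolute homogeneity, and the triangle inequality for all X, Y in V_b with X+Y in V_b. *)

theory Defs
  imports "HOL-Probability.Probability"
begin

text \<open>Functions on \<open>(0,\<infinity>)\<close> are represented by total functions on the reals of which only the
  values on \<open>{0<..}\<close> matter.\<close>

definition slowly_varying :: "(real \<Rightarrow> real) \<Rightarrow> bool" where
  "slowly_varying L \<longleftrightarrow>
     L \<in> borel_measurable (restrict_space borel {0<..}) \<and>
     (\<forall>s>0. 0 < L s) \<and>
     (\<forall>x>0. ((\<lambda>s. L (s * x) / L s) \<longlongrightarrow> 1) at_top)"

definition normalizing_function :: "real \<Rightarrow> (real \<Rightarrow> real) \<Rightarrow> bool" where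
  "normalizing_function \<alpha> b \<longleftrightarrow>
     0 < \<alpha> \<and> (\<exists>L. slowly_varying L \<and> (\<forall>s>0. b s = s powr \<alpha> * L s))"

text \<open>The elements of \<open>\<V>\<^sub>b\<close> are random variables themselves, not almost-sure equivalence classes.\<close>

definition tail_space :: "'a measure \<Rightarrow> (real \<Rightarrow> real) \<Rightarrow> ('a \<Rightarrow> real) set" where
  "tail_space M b =
     {X \<in> borel_measurable M. \<forall>x>0.
        (\<exists>l. ((\<lambda>s. b s * measure M {\<omega> \<in> space M. X \<omega> > s * x}) \<longlongrightarrow> l) at_top) \<and>
        (\<exists>l. ((\<lambda>s. b s * measure M {\<omega> \<in> space M. X \<omega> < - (s * x)}) \<longlongrightarrow> l) at_top)}"

definition tail_scale :: "'a measure \<Rightarrow> (real \<Rightarrow> real) \<Rightarrow> ('a \<Rightarrow> real) \<Rightarrow> real" where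
  "tail_scale M b X = Lim at_top (\<lambda>s. b s * measure M {\<omega> \<in> space M. \<bar>X \<omega>\<bar> > s})"

definition tail_norm :: "'a measure \<Rightarrow> real \<Rightarrow> (real \<Rightarrow> real) \<Rightarrow> ('a \<Rightarrow> real) \<Rightarrow> real" where
  "tail_norm M \<alpha> b X = tail_scale M b X powr (1 / \<alpha>)"

text \<open>The limit in \<^const>\<open>tail_scale\<close> exists on all of \<^const>\<open>tail_space\<close>, so the use of
  \<^const>\<open>Lim\<close> is unproblematic there.\<close>

lemma tail_scale_tendsto:
  assumes "prob_space M" and X: "X \<in> tail_space M b"
  shows "((\<lambda>s. b s * measure M {\<omega> \<in> space M. \<bar>X \<omega>\<bar> > s}) \<longlongrightarrow> tail_scale M b X) at_top"
proof -
  interpret prob_space M by fact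
  have [measurable]: "X \<in> borel_measurable M"
    using X by (simp add: tail_space_def)
  let ?P = "\<lambda>s. measure M {\<omega> \<in> space M. X \<omega> > s}"
  let ?N = "\<lambda>s. measure M {\<omega> \<in> space M. X \<omega> < - s}"
  obtain l where l: "((\<lambda>s. b s * ?P s) \<longlongrightarrow> l) at_top"
    using X by (auto simp: tail_space_def dest!: spec[of _ "1::real"])
  obtain m where m: "((\<lambda>s. b s * ?N s) \<longlongrightarrow> m) at_top"
    using X by (auto simp: tail_space_def dest!: spec[of _ "1::real"])
  have split: "measure M {\<omega> \<in> space M. \<bar>X \<omega>\<bar> > s} = ?P s + ?N s" if "s > 0" for s
  proof -
    have "{\<omega> \<in> space M. \<bar>X \<omega>\<bar> > s} =
        {\<omega> \<in> space M. X \<omega> > s} \<union> {\<omega> \<in> space M. X \<omega> < - s}"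
      using that by auto
    also have "measure M \<dots> = ?P s + ?N s"
      using that by (intro finite_measure_Union) auto
    finally show ?thesis .
  qed
  have "((\<lambda>s. b s * ?P s + b s * ?N s) \<longlongrightarrow> l + m) at_top"
    by (intro tendsto_add l m)
  moreover have "\<forall>\<^sub>F s in at_top. b s * ?P s + b s * ?N s =
      b s * measure M {\<omega> \<in> space M. \<bar>X \<omega>\<bar> > s}"
    using eventually_gt_at_top[of 0] by eventually_elim (simp add: split distrib_left)
  ultimately have lim: "((\<lambda>s. b s * measure M {\<omega> \<in> space M. \<bar>X \<omega>\<bar> > s}) \<longlongrightarrow> l + m) at_top"
    by (rule Lim_transform_eventually)
  have "tail_scale M b X = l + m"
    unfolding tail_scale_def by (rule tendsto_Lim[OF _ lim]) simp
  with lim show ?thesis by simp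
qed

text \<open>Seminorms on a set \<open>V\<close> of real functions, under pointwise addition and scalar
  multiplication. Addition on \<open>V\<close> may be partial: the triangle inequality is required of all
  \<open>X, Y \<in> V\<close> whose sum is again in \<open>V\<close>, i.e. whenever its left-hand side is defined; if \<open>V\<close> is a
  linear space this is the usual notion. The generality is needed for \<^const>\<open>tail_space\<close>, which is
  closed under scalar multiplication but in general not under addition: two dependent variables
  with the same regularly varying law can be comonotone at some scales and essentially never
  large together at others, so that the normalized tail of their sum oscillates.\<close>

definition seminorm_on :: "('a \<Rightarrow> real) set \<Rightarrow> (('a \<Rightarrow> real) \<Rightarrow> real) \<Rightarrow> bool" where
  "seminorm_on V p \<longleftrightarrow>
     (\<lambda>\<omega>. 0) \<in> V \<and>
     (\<forall>X\<in>V. 0 \<le> p X) \<and>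
     (\<forall>X\<in>V. \<forall>c. (\<lambda>\<omega>. c * X \<omega>) \<in> V \<and> p (\<lambda>\<omega>. c * X \<omega>) = \<bar>c\<bar> * p X) \<and>
     (\<forall>X\<in>V. \<forall>Y\<in>V. (\<lambda>\<omega>. X \<omega> + Y \<omega>) \<in> V \<longrightarrow> p (\<lambda>\<omega>. X \<omega> + Y \<omega>) \<le> p X + p Y)"

end

theory Submission imports Defs begin

text \<open>For \<open>h > 0\<close> and \<open>n\<close> steps, the number of thresholds \<open>j h\<close>, \<open>j < n\<close>, exceeded by a real number
  is subadditive in that number. Applied to \<open>\<bar>X + Y\<bar> - s \<le> (\<bar>X\<bar> - p s) + (\<bar>Y\<bar> - q s)\<close> with
  \<open>p + q = 1\<close> and integrated, this compares finite sums of tail probabilities. After multiplication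
  by \<open>b s\<close> and passage to the limit, the three sums become Riemann sums of \<open>\<integral> u\<^sup>-\<^sup>\<alpha> du\<close>
  over \<open>[1,\<infinity>)\<close>, \<open>[p,\<infinity>)\<close> and \<open>[q,\<infinity>)\<close>; these integrals are finite because \<open>\<alpha> > 1\<close>. Hence
  \<open>\<kappa>\<^sub>X\<^sub>+\<^sub>Y \<le> \<kappa>\<^sub>X p\<^bsup>1-\<alpha>\<^esup> + \<kappa>\<^sub>Y q\<^bsup>1-\<alpha>\<^esup>\<close>, and minimizing over \<open>p\<close> yields the triangle inequality.
  Working with finitely many thresholds makes Karamata's theorem on integrated tails superfluous.\<close>

section \<open>Threshold counts and sums of tail probabilities\<close>

text \<open>If every threshold lies below \<open>a\<close>, the count for \<open>a\<close> is
  already \<open>n\<close>. Otherwise let \<open>k\<close> be the first index with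
  \<open>k h \<ge> a\<close>: the \<open>k\<close> earlier thresholds are counted for
  \<open>a\<close>, and an index \<open>j \<ge> k\<close> counted for \<open>a + b\<close> has
  \<open>(j - k) h < b\<close>, so the shift by \<open>k\<close> embeds the remaining indices into
  those counted for \<open>b\<close>.\<close>

lemma card_thresholds_add_le:
  fixes a b h :: real
  shows "card {j. j < n \<and> real j * h < a + b}
    \<le> card {j. j < n \<and> real j * h < a} + card {j. j < n \<and> real j * h < b}"
proof (cases "\<forall>j<n. real j * h < a")
  case True
  then have "{j. j < n \<and> real j * h < a + b} \<subseteq> {j. j < n \<and> real j * h < a}" by auto
  then have "card {j. j < n \<and> real j * h < a + b} \<le> card {j. j < n \<and> real j * h < a}"
    by (intro card_mono) auto
  then show ?thesis by simp
next
  case False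
  define k where "k = (LEAST j. \<not> real j * h < a)"
  obtain i where "i < n" "\<not> real i * h < a" using False by auto
  have k: "\<not> real k * h < a"
    unfolding k_def by (rule LeastI) fact
  have "k \<le> i" unfolding k_def by (rule Least_le) fact
  with \<open>i < n\<close> have "k < n" by simp
  have below: "real j * h < a" if "j < k" for j
    using that not_less_Least unfolding k_def by blast
  have "{..<k} \<subseteq> {j. j < n \<and> real j * h < a}" using below \<open>k < n\<close> by auto
  then have "card {..<k} \<le> card {j. j < n \<and> real j * h < a}" by (intro card_mono) auto
  then have k_le: "k \<le> card {j. j < n \<and> real j * h < a}" by simp
  have "{j. j < n \<and> real j * h < a + b} \<subseteq>
      {..<k} \<union> (\<lambda>i. i + k) ` {j. j < n \<and> real j * h < b}"
  proof
    fix j assume j: "j \<in> {j. j < n \<and> real j * h < a + b}"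
    show "j \<in> {..<k} \<union> (\<lambda>i. i + k) ` {j. j < n \<and> real j * h < b}"
    proof (cases "j < k")
      case False
      then have "real (j - k) * h = real j * h - real k * h"
        by (simp add: of_nat_diff algebra_simps)
      then have "j - k \<in> {j. j < n \<and> real j * h < b}" using j k by auto
      then show ?thesis using False by (auto intro: image_eqI[of _ _ "j - k"])
    qed simp
  qed
  then have "card {j. j < n \<and> real j * h < a + b} \<le>
      card ({..<k} \<union> (\<lambda>i. i + k) ` {j. j < n \<and> real j * h < b})"
    by (intro card_mono) auto
  also have "\<dots> \<le> card {..<k} + card ((\<lambda>i. i + k) ` {j. j < n \<and> real j * h < b})"
    by (rule card_Un_le)
  also have "\<dots> \<le> k + card {j. j < n \<and> real j * h < b}"
    by (simp add: card_image_le)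
  finally show ?thesis using k_le by simp
qed

text \<open>The count is a finite sum of indicators, so integration turns a pointwise inequality
  between counts into one between sums of tail probabilities.\<close>

lemma (in finite_measure) sum_measure_eq_integral_card:
  fixes f :: "'a \<Rightarrow> real" and n :: nat
  assumes [measurable]: "f \<in> borel_measurable M"
  shows "integrable M (\<lambda>\<omega>. real (card {j. j < n \<and> t j < f \<omega>}))"
    and "(\<Sum>j<n. measure M {\<omega> \<in> space M. f \<omega> > t j}) =
      (\<integral>\<omega>. real (card {j. j < n \<and> t j < f \<omega>}) \<partial>M)"
proof -
  have card_eq: "real (card {j. j < n \<and> t j < f \<omega>}) =
      (\<Sum>j<n. indicator {\<omega> \<in> space M. f \<omega> > t j} \<omega>)" if "\<omega> \<in> space M" for \<omega>
  proof -
    have "(\<Sum>j<n. indicator {\<omega> \<in> space M. f \<omega> > t j} \<omega>) =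
        (\<Sum>j<n. if t j < f \<omega> then 1 else (0::real))"
      using that by (intro sum.cong) auto
    also have "\<dots> = (\<Sum>j\<in>{j \<in> {..<n}. t j < f \<omega>}. 1)"
      by (rule sum.inter_filter [symmetric]) simp
    also have "\<dots> = real (card {j. j < n \<and> t j < f \<omega>})" by simp
    finally show ?thesis by simp
  qed
  have int: "integrable M (\<lambda>\<omega>. indicator {\<omega> \<in> space M. f \<omega> > t j} \<omega> :: real)" for j
    by (rule integrable_real_indicator) (auto simp: emeasure_eq_measure)
  show "integrable M (\<lambda>\<omega>. real (card {j. j < n \<and> t j < f \<omega>}))"
    using int by (subst Bochner_Integration.integrable_cong[OF refl card_eq]) auto
  have "(\<integral>\<omega>. real (card {j. j < n \<and> t j < f \<omega>}) \<partial>M) =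
      (\<integral>\<omega>. (\<Sum>j<n. indicator {\<omega> \<in> space M. f \<omega> > t j} \<omega>) \<partial>M)"
    by (rule Bochner_Integration.integral_cong) (auto simp: card_eq)
  also have "\<dots> = (\<Sum>j<n. \<integral>\<omega>. indicator {\<omega> \<in> space M. f \<omega> > t j} \<omega> \<partial>M)"
    by (rule Bochner_Integration.integral_sum) (rule int)
  also have "\<dots> = (\<Sum>j<n. measure M {\<omega> \<in> space M. f \<omega> > t j})"
    by (intro sum.cong) (auto intro!: arg_cong[of _ _ "measure M"])
  finally show "(\<Sum>j<n. measure M {\<omega> \<in> space M. f \<omega> > t j}) =
      (\<integral>\<omega>. real (card {j. j < n \<and> t j < f \<omega>}) \<partial>M)" by simp
qed

lemma (in finite_measure) sum_tails_add_le:
  fixes X Y :: "'a \<Rightarrow> real"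
  assumes [measurable]: "X \<in> borel_measurable M" "Y \<in> borel_measurable M"
    and pq: "p + q = 1"
  shows "(\<Sum>j<n. measure M {\<omega> \<in> space M. \<bar>X \<omega> + Y \<omega>\<bar> > s * (1 + real j * h)})
    \<le> (\<Sum>j<n. measure M {\<omega> \<in> space M. \<bar>X \<omega>\<bar> > s * (p + real j * h)})
     + (\<Sum>j<n. measure M {\<omega> \<in> space M. \<bar>Y \<omega>\<bar> > s * (q + real j * h)})"
proof -
  let ?N = "\<lambda>c Z \<omega>. card {j. j < n \<and> s * (c + real j * h) < \<bar>Z \<omega>\<bar>}"
  let ?Z = "\<lambda>\<omega>. X \<omega> + Y \<omega>"
  \<comment> \<open>Moving the offset \<open>s * c\<close> to the other side leaves equally spaced
    thresholds starting at 0 with step \<open>s * h\<close>, the form required by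
    \<open>card_thresholds_add_le\<close>.\<close>
  have shift: "card {j. j < n \<and> s * (c + real j * h) < z} =
      card {j. j < n \<and> real j * (s * h) < z - s * c}" for c z
    by (rule arg_cong[of _ _ card]) (auto simp: algebra_simps)
  have le: "real (?N 1 ?Z \<omega>) \<le> real (?N p X \<omega>) + real (?N q Y \<omega>)" for \<omega>
  proof -
    have "s * p + s * q = s" using pq by (metis distrib_left mult.right_neutral)
    then have "\<bar>?Z \<omega>\<bar> - s * 1 \<le> (\<bar>X \<omega>\<bar> - s * p) + (\<bar>Y \<omega>\<bar> - s * q)" by simp
    then have "?N 1 ?Z \<omega> \<le>
        card {j. j < n \<and> real j * (s * h) < (\<bar>X \<omega>\<bar> - s * p) + (\<bar>Y \<omega>\<bar> - s * q)}"
      unfolding shift by (intro card_mono) auto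
    also have "\<dots> \<le> ?N p X \<omega> + ?N q Y \<omega>"
      unfolding shift by (rule card_thresholds_add_le)
    finally show ?thesis by simp
  qed
  note I = sum_measure_eq_integral_card[where n = n]
  have "(\<integral>\<omega>. real (?N 1 ?Z \<omega>) \<partial>M) \<le> (\<integral>\<omega>. real (?N p X \<omega>) + real (?N q Y \<omega>) \<partial>M)"
    by (intro integral_mono Bochner_Integration.integrable_add I(1) le) measurable
  also have "\<dots> = (\<integral>\<omega>. real (?N p X \<omega>) \<partial>M) + (\<integral>\<omega>. real (?N q Y \<omega>) \<partial>M)"
    by (intro Bochner_Integration.integral_add I(1)) measurable
  finally show ?thesis by (subst (1 2 3) I(2)) measurable
qed

section \<open>Riemann sums of a negative power\<close>

text \<open>The quotient is the integral of the decreasing function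
  \<open>t powr (- \<alpha>)\<close> over \<open>[u, u + h]\<close>, here bounded by its endpoint
  values. The mean value theorem for an antiderivative stands in for the integral.\<close>

lemma powr_diff_bounds:
  fixes u h \<alpha> :: real
  assumes "u > 0" "h > 0" "\<alpha> > 1"
  shows "(u powr (1 - \<alpha>) - (u + h) powr (1 - \<alpha>)) / (\<alpha> - 1) \<le> h * u powr (- \<alpha>)"
    and "h * (u + h) powr (- \<alpha>) \<le> (u powr (1 - \<alpha>) - (u + h) powr (1 - \<alpha>)) / (\<alpha> - 1)"
proof -
  have "\<exists>z. u < z \<and> z < u + h \<and> (u + h) powr (1 - \<alpha>) / (\<alpha> - 1) - u powr (1 - \<alpha>) / (\<alpha> - 1)
      = (u + h - u) * (- (z powr (- \<alpha>)))"
  proof (rule MVT2)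
    fix x assume "u \<le> x" "x \<le> u + h"
    then have "x > 0" using assms by simp
    with assms have "((\<lambda>x. x powr (1 - \<alpha>) / (\<alpha> - 1)) has_real_derivative
        (1 - \<alpha>) * x powr (1 - \<alpha> - 1) / (\<alpha> - 1)) (at x)"
      by (auto intro!: derivative_eq_intros)
    moreover have "(1 - \<alpha>) * x powr (1 - \<alpha> - 1) / (\<alpha> - 1) = - (x powr (- \<alpha>))"
      using assms by (simp add: divide_eq_eq algebra_simps)
    ultimately show "((\<lambda>x. x powr (1 - \<alpha>) / (\<alpha> - 1)) has_real_derivative - (x powr (- \<alpha>))) (at x)"
      by simp
  qed (use assms in simp)
  then obtain z where z: "u < z" "z < u + h"
    and eq: "(u powr (1 - \<alpha>) - (u + h) powr (1 - \<alpha>)) / (\<alpha> - 1) = h * z powr (- \<alpha>)"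
    by (auto simp: diff_divide_distrib)
  have "z powr (- \<alpha>) \<le> u powr (- \<alpha>)" "(u + h) powr (- \<alpha>) \<le> z powr (- \<alpha>)"
    using z assms by (auto intro!: powr_mono2')
  then show "(u powr (1 - \<alpha>) - (u + h) powr (1 - \<alpha>)) / (\<alpha> - 1) \<le> h * u powr (- \<alpha>)"
    and "h * (u + h) powr (- \<alpha>) \<le> (u powr (1 - \<alpha>) - (u + h) powr (1 - \<alpha>)) / (\<alpha> - 1)"
    unfolding eq using assms by auto
qed

text \<open>The left-endpoint bounds telescope to the integral over
  \<open>[u, u + n h]\<close>.\<close>

lemma powr_riemann_sum_ge:
  fixes u h \<alpha> :: real
  assumes "u > 0" "h > 0" "\<alpha> > 1"
  shows "(u powr (1 - \<alpha>) - (u + real n * h) powr (1 - \<alpha>)) / (\<alpha> - 1)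
    \<le> h * (\<Sum>j<n. (u + real j * h) powr (- \<alpha>))"
proof (induction n)
  case (Suc n)
  have "u + real n * h > 0" using assms by (simp add: add_pos_nonneg)
  from powr_diff_bounds(1)[OF this \<open>h > 0\<close> \<open>\<alpha> > 1\<close>] Suc show ?case
    by (simp add: algebra_simps diff_divide_distrib)
qed simp

text \<open>The term \<open>j = 0\<close> is kept as it stands; each later term is a right-endpoint
  value and is absorbed by the integral over the step before it. Dropping the upper end of the
  integral makes the bound uniform in \<open>n\<close>.\<close>

lemma powr_riemann_sum_le:
  fixes u h \<alpha> :: real
  assumes "u > 0" "h > 0" "\<alpha> > 1"
  shows "h * (\<Sum>j<n. (u + real j * h) powr (- \<alpha>)) \<le> h * u powr (- \<alpha>) + u powr (1 - \<alpha>) / (\<alpha> - 1)"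
proof -
  \<comment> \<open>With \<open>Suc n\<close> terms, exactly \<open>n\<close> remain after the
    first, matching the \<open>n\<close> steps from \<open>u\<close> to
    \<open>u + n h\<close>.\<close>
  have *: "h * (\<Sum>j<Suc n. (u + real j * h) powr (- \<alpha>)) \<le>
      h * u powr (- \<alpha>) + (u powr (1 - \<alpha>) - (u + real n * h) powr (1 - \<alpha>)) / (\<alpha> - 1)"
  proof (induction n)
    case (Suc n)
    have "u + real n * h > 0" using assms by (simp add: add_pos_nonneg)
    from powr_diff_bounds(2)[OF this \<open>h > 0\<close> \<open>\<alpha> > 1\<close>] Suc show ?case
      by (simp add: algebra_simps diff_divide_distrib)
  qed simp
  have "(\<Sum>j<n. (u + real j * h) powr (- \<alpha>)) \<le> (\<Sum>j<Suc n. (u + real j * h) powr (- \<alpha>))"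
    by simp
  then have "h * (\<Sum>j<n. (u + real j * h) powr (- \<alpha>)) \<le> h * (\<Sum>j<Suc n. (u + real j * h) powr (- \<alpha>))"
    using assms by (intro mult_left_mono) auto
  also note *
  also have "h * u powr (- \<alpha>) + (u powr (1 - \<alpha>) - (u + real n * h) powr (1 - \<alpha>)) / (\<alpha> - 1) \<le>
      h * u powr (- \<alpha>) + u powr (1 - \<alpha>) / (\<alpha> - 1)"
    using assms by (intro add_left_mono divide_right_mono) auto
  finally show ?thesis .
qed

section \<open>Regular variation of the normalized tails\<close>

lemma normalizing_function_pos:
  assumes "normalizing_function \<alpha> b" "s > 0"
  shows "b s > 0"
  using assms by (auto simp: normalizing_function_def slowly_varying_def)

lemma normalizing_function_ratio:
  assumes b: "normalizing_function \<alpha> b" and x: "x > 0"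
  shows "((\<lambda>s. b s / b (s * x)) \<longlongrightarrow> x powr (- \<alpha>)) at_top"
proof -
  from b obtain L where L: "\<And>s. s > 0 \<Longrightarrow> L s > 0" "((\<lambda>s. L (s * x) / L s) \<longlongrightarrow> 1) at_top"
    and bL: "\<And>s. s > 0 \<Longrightarrow> b s = s powr \<alpha> * L s"
    using x by (auto simp: normalizing_function_def slowly_varying_def)
  have "((\<lambda>s. x powr (- \<alpha>) * inverse (L (s * x) / L s)) \<longlongrightarrow> x powr (- \<alpha>) * inverse 1) at_top"
    by (intro tendsto_intros L) simp
  moreover have "\<forall>\<^sub>F s in at_top. x powr (- \<alpha>) * inverse (L (s * x) / L s) = b s / b (s * x)"
    using eventually_gt_at_top[of 0]
  proof eventually_elim
    case (elim s)
    then have "L s > 0" "L (s * x) > 0" "s powr \<alpha> > 0" "x powr \<alpha> > 0" using x L by auto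
    then show ?case using elim x
      by (simp add: bL powr_mult powr_minus field_simps)
  qed
  ultimately have "((\<lambda>s. b s / b (s * x)) \<longlongrightarrow> x powr (- \<alpha>) * inverse 1) at_top"
    by (rule Lim_transform_eventually)
  then show ?thesis by simp
qed

text \<open>Substituting \<open>s * x\<close> for \<open>s\<close> in the defining limit normalizes
  by \<open>b (s * x)\<close>; the ratio \<open>b s / b (s * x)\<close> restores \<open>b s\<close>
  and contributes the factor \<open>x powr (- \<alpha>)\<close>.\<close>

lemma tail_scale_tendsto_scaled:
  assumes "prob_space M" and b: "normalizing_function \<alpha> b"
    and X: "X \<in> tail_space M b" and x: "x > 0"
  shows "((\<lambda>s. b s * measure M {\<omega> \<in> space M. \<bar>X \<omega>\<bar> > s * x}) \<longlongrightarrow>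
    tail_scale M b X * x powr (- \<alpha>)) at_top"
proof -
  have "filterlim (\<lambda>s. s * x) at_top at_top"
    using x by (intro filterlim_at_top_mult_tendsto_pos[OF tendsto_const] filterlim_ident)
  from filterlim_compose[OF tail_scale_tendsto[OF assms(1) X] this]
  have "((\<lambda>s. (b (s * x) * measure M {\<omega> \<in> space M. \<bar>X \<omega>\<bar> > s * x}) * (b s / b (s * x))) \<longlongrightarrow>
      tail_scale M b X * x powr (- \<alpha>)) at_top"
    by (intro tendsto_mult normalizing_function_ratio[OF b x])
  moreover have "\<forall>\<^sub>F s in at_top.
      (b (s * x) * measure M {\<omega> \<in> space M. \<bar>X \<omega>\<bar> > s * x}) * (b s / b (s * x)) =
      b s * measure M {\<omega> \<in> space M. \<bar>X \<omega>\<bar> > s * x}"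
    using eventually_gt_at_top[of 0]
  proof eventually_elim
    case (elim s)
    then have "b (s * x) > 0" using x normalizing_function_pos[OF b] by simp
    then show ?case by simp
  qed
  ultimately show ?thesis by (rule Lim_transform_eventually)
qed

lemma tail_scale_nonneg:
  assumes "prob_space M" "normalizing_function \<alpha> b" "X \<in> tail_space M b"
  shows "tail_scale M b X \<ge> 0"
proof (rule tendsto_lowerbound[OF tail_scale_tendsto[OF assms(1,3)]])
  show "\<forall>\<^sub>F s in at_top. 0 \<le> b s * measure M {\<omega> \<in> space M. \<bar>X \<omega>\<bar> > s}"
    using eventually_gt_at_top[of 0]
    by eventually_elim (simp add: normalizing_function_pos[OF assms(2)] less_imp_le)
qed simp

section \<open>The zero variable and scalar multiples\<close>

lemma zero_in_tail_space: "(\<lambda>\<omega>. 0) \<in> tail_space M b"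
proof -
  have "((\<lambda>s. b s * measure M {\<omega> \<in> space M. s * x < 0}) \<longlongrightarrow> 0) at_top"
    "((\<lambda>s. b s * measure M {\<omega> \<in> space M. 0 < - (s * x)}) \<longlongrightarrow> 0) at_top" if "x > 0" for x :: real
    by (rule tendsto_eventually, use eventually_gt_at_top[of 0] in eventually_elim,
        use that in \<open>simp add: mult_less_0_iff zero_less_mult_iff\<close>)+
  then show ?thesis unfolding tail_space_def by auto
qed

lemma tail_scale_zero: "tail_scale M b (\<lambda>\<omega>. 0) = 0"
  unfolding tail_scale_def
  by (rule tendsto_Lim, simp, rule tendsto_eventually, use eventually_gt_at_top[of 0] in eventually_elim) simp

lemma scale_in_tail_space:
  assumes X: "X \<in> tail_space M b"
  shows "(\<lambda>\<omega>. c * X \<omega>) \<in> tail_space M b"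
proof (cases "c = 0")
  case True
  then show ?thesis by (simp add: zero_in_tail_space)
next
  case False
  have [measurable]: "X \<in> borel_measurable M" using X by (simp add: tail_space_def)
  have lims: "\<exists>l. ((\<lambda>s. b s * measure M {\<omega> \<in> space M. X \<omega> > s * (x / \<bar>c\<bar>)}) \<longlongrightarrow> l) at_top"
    "\<exists>l. ((\<lambda>s. b s * measure M {\<omega> \<in> space M. X \<omega> < - (s * (x / \<bar>c\<bar>))}) \<longlongrightarrow> l) at_top"
    if "x > 0" for x
    using X that False unfolding tail_space_def by (auto simp del: times_divide_eq_right)
  consider "c > 0" | "c < 0" using False by linarith
  then show ?thesis
  proof cases
    case 1
    then have "c * y > s * x \<longleftrightarrow> y > s * (x / \<bar>c\<bar>)" "c * y < - (s * x) \<longleftrightarrow> y < - (s * (x / \<bar>c\<bar>))"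
      for y s x :: real by (simp_all add: field_simps)
    then show ?thesis using lims unfolding tail_space_def by simp
  next
    case 2
    \<comment> \<open>A negative factor exchanges the upper and the lower tail.\<close>
    then have "c * y > s * x \<longleftrightarrow> y < - (s * (x / \<bar>c\<bar>))" "c * y < - (s * x) \<longleftrightarrow> y > s * (x / \<bar>c\<bar>)"
      for y s x :: real by (simp_all add: field_simps)
    then show ?thesis using lims unfolding tail_space_def by simp
  qed
qed

lemma tail_scale_scale:
  assumes M: "prob_space M" and b: "normalizing_function \<alpha> b"
    and X: "X \<in> tail_space M b" and c: "c \<noteq> 0"
  shows "tail_scale M b (\<lambda>\<omega>. c * X \<omega>) = \<bar>c\<bar> powr \<alpha> * tail_scale M b X"
proof -
  have "\<bar>c * y\<bar> > s \<longleftrightarrow> \<bar>y\<bar> > s * (1 / \<bar>c\<bar>)" for y s :: real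
    using c by (simp add: abs_mult field_simps)
  then have "((\<lambda>s. b s * measure M {\<omega> \<in> space M. \<bar>c * X \<omega>\<bar> > s}) \<longlongrightarrow>
      tail_scale M b X * (1 / \<bar>c\<bar>) powr (- \<alpha>)) at_top"
    using tail_scale_tendsto_scaled[OF M b X, of "1 / \<bar>c\<bar>"] c by simp
  then have "tail_scale M b (\<lambda>\<omega>. c * X \<omega>) = tail_scale M b X * (1 / \<bar>c\<bar>) powr (- \<alpha>)"
    unfolding tail_scale_def[of M b "\<lambda>\<omega>. c * X \<omega>"] by (intro tendsto_Lim) simp_all
  also have "(1 / \<bar>c\<bar>) powr (- \<alpha>) = \<bar>c\<bar> powr \<alpha>"
    using c by (simp add: powr_divide powr_minus field_simps)
  finally show ?thesis by (simp add: mult.commute)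
qed

section \<open>The triangle inequality\<close>

lemma tail_scale_add_le:
  assumes M: "prob_space M" and b: "normalizing_function \<alpha> b" and \<alpha>: "\<alpha> > 1"
    and X: "X \<in> tail_space M b" and Y: "Y \<in> tail_space M b"
    and Z: "(\<lambda>\<omega>. X \<omega> + Y \<omega>) \<in> tail_space M b"
    and p: "p > 0" and q: "q > 0" and pq: "p + q = 1"
  shows "tail_scale M b (\<lambda>\<omega>. X \<omega> + Y \<omega>) \<le>
    tail_scale M b X * p powr (1 - \<alpha>) + tail_scale M b Y * q powr (1 - \<alpha>)"
proof -
  interpret prob_space M by fact
  let ?Z = "\<lambda>\<omega>. X \<omega> + Y \<omega>"
  let ?kX = "tail_scale M b X" and ?kY = "tail_scale M b Y" and ?kZ = "tail_scale M b ?Z"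
  let ?S = "\<lambda>n h u. \<Sum>j<n. (u + real j * h) powr (- \<alpha>)"
  note nonneg = tail_scale_nonneg[OF M b]
  have meas: "X \<in> borel_measurable M" "Y \<in> borel_measurable M"
    using X Y by (auto simp: tail_space_def)
  have lim: "((\<lambda>s. b s * (\<Sum>j<n. measure M {\<omega> \<in> space M. \<bar>W \<omega>\<bar> > s * (u + real j * h)})) \<longlongrightarrow>
      tail_scale M b W * ?S n h u) at_top"
    if "W \<in> tail_space M b" "u > 0" "h > 0" for W u h n
    unfolding sum_distrib_left
    by (intro tendsto_sum tail_scale_tendsto_scaled[OF M b] that add_pos_nonneg)
      (use that in auto)
  \<comment> \<open>The limits are taken in the order \<open>s\<close>, \<open>n\<close>,
    \<open>h\<close>: here \<open>s\<close> tends to infinity with \<open>n\<close> and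
    \<open>h\<close> fixed, so that only finitely many tails are involved.\<close>
  have sums: "?kZ * ?S n h 1 \<le> ?kX * ?S n h p + ?kY * ?S n h q" if h: "h > 0" for h n
  proof (rule tendsto_le[OF _ tendsto_add[OF lim[OF X p h] lim[OF Y q h]] lim[OF Z zero_less_one h]])
    show "\<forall>\<^sub>F s in at_top.
      b s * (\<Sum>j<n. measure M {\<omega> \<in> space M. \<bar>?Z \<omega>\<bar> > s * (1 + real j * h)}) \<le>
      b s * (\<Sum>j<n. measure M {\<omega> \<in> space M. \<bar>X \<omega>\<bar> > s * (p + real j * h)}) +
      b s * (\<Sum>j<n. measure M {\<omega> \<in> space M. \<bar>Y \<omega>\<bar> > s * (q + real j * h)})"
      using eventually_gt_at_top[of 0]
    proof eventually_elim
      case (elim s)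
      then show ?case
        using sum_tails_add_le[OF meas pq] normalizing_function_pos[OF b]
        by (simp flip: distrib_left)
    qed
  qed simp
  \<comment> \<open>Multiplying by \<open>h\<close> gives true Riemann sums: the one for the sum is
    bounded from below, the other two from above and independently of \<open>n\<close>.\<close>
  have bound: "?kZ * ((1 - (1 + real n * h) powr (1 - \<alpha>)) / (\<alpha> - 1)) \<le>
      ?kX * (h * p powr (- \<alpha>) + p powr (1 - \<alpha>) / (\<alpha> - 1)) +
      ?kY * (h * q powr (- \<alpha>) + q powr (1 - \<alpha>) / (\<alpha> - 1))" if h: "h > 0" for h n
  proof -
    have "?kZ * ((1 - (1 + real n * h) powr (1 - \<alpha>)) / (\<alpha> - 1)) \<le> ?kZ * (h * ?S n h 1)"
      using powr_riemann_sum_ge[OF zero_less_one h \<alpha>, of n] nonneg[OF Z]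
      by (intro mult_left_mono) auto
    also have "\<dots> = h * (?kZ * ?S n h 1)" by simp
    also have "\<dots> \<le> h * (?kX * ?S n h p + ?kY * ?S n h q)"
      using sums[OF h] h by (intro mult_left_mono) auto
    also have "\<dots> = ?kX * (h * ?S n h p) + ?kY * (h * ?S n h q)"
      by (simp add: algebra_simps)
    also have "\<dots> \<le> ?kX * (h * p powr (- \<alpha>) + p powr (1 - \<alpha>) / (\<alpha> - 1)) +
      ?kY * (h * q powr (- \<alpha>) + q powr (1 - \<alpha>) / (\<alpha> - 1))"
      by (intro add_mono mult_left_mono powr_riemann_sum_le nonneg X Y p q h \<alpha>)
    finally show ?thesis .
  qed
  \<comment> \<open>Let \<open>n\<close> tend to infinity. The \<open>0\<close> is the limit of the
    power with negative exponent \<open>1 - \<alpha>\<close>.\<close>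
  have bound_h: "?kZ * ((1 - 0) / (\<alpha> - 1)) \<le>
      ?kX * (h * p powr (- \<alpha>) + p powr (1 - \<alpha>) / (\<alpha> - 1)) +
      ?kY * (h * q powr (- \<alpha>) + q powr (1 - \<alpha>) / (\<alpha> - 1))" if h: "h > 0" for h
  proof (rule LIMSEQ_le_const2)
    have "filterlim (\<lambda>n. 1 + real n * h) at_top sequentially"
      using h by (intro filterlim_tendsto_add_at_top[OF tendsto_const]
          filterlim_at_top_mult_tendsto_pos[OF tendsto_const] filterlim_real_sequentially)
    then have "(\<lambda>n. (1 + real n * h) powr (1 - \<alpha>)) \<longlonglongrightarrow> 0"
      using \<alpha> by (intro tendsto_neg_powr) auto
    then show "(\<lambda>n. ?kZ * ((1 - (1 + real n * h) powr (1 - \<alpha>)) / (\<alpha> - 1))) \<longlonglongrightarrow>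
        ?kZ * ((1 - 0) / (\<alpha> - 1))"
      using \<alpha> by (intro tendsto_intros) auto
  qed (use bound[OF h] in blast)
  \<comment> \<open>Let \<open>h\<close> decrease to 0, which removes the first terms
    \<open>h * p powr (- \<alpha>)\<close> and \<open>h * q powr (- \<alpha>)\<close>.\<close>
  have "?kZ * ((1 - 0) / (\<alpha> - 1)) \<le>
      ?kX * (0 * p powr (- \<alpha>) + p powr (1 - \<alpha>) / (\<alpha> - 1)) +
      ?kY * (0 * q powr (- \<alpha>) + q powr (1 - \<alpha>) / (\<alpha> - 1))"
  proof (rule tendsto_lowerbound)
    show "((\<lambda>h. ?kX * (h * p powr (- \<alpha>) + p powr (1 - \<alpha>) / (\<alpha> - 1)) +
      ?kY * (h * q powr (- \<alpha>) + q powr (1 - \<alpha>) / (\<alpha> - 1))) \<longlongrightarrow>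
      ?kX * (0 * p powr (- \<alpha>) + p powr (1 - \<alpha>) / (\<alpha> - 1)) +
      ?kY * (0 * q powr (- \<alpha>) + q powr (1 - \<alpha>) / (\<alpha> - 1))) (at_right 0)"
      by (intro tendsto_intros)
    show "\<forall>\<^sub>F h in at_right 0. ?kZ * ((1 - 0) / (\<alpha> - 1)) \<le>
      ?kX * (h * p powr (- \<alpha>) + p powr (1 - \<alpha>) / (\<alpha> - 1)) +
      ?kY * (h * q powr (- \<alpha>) + q powr (1 - \<alpha>) / (\<alpha> - 1))"
      using bound_h by (simp add: eventually_at_filter)
  qed simp
  then have "?kZ / (\<alpha> - 1) \<le> (?kX * p powr (1 - \<alpha>) + ?kY * q powr (1 - \<alpha>)) / (\<alpha> - 1)"
    by (simp add: add_divide_distrib)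
  then show ?thesis using \<alpha> by (simp add: divide_le_cancel)
qed

lemma tail_norm_triangle:
  assumes M: "prob_space M" and b: "normalizing_function \<alpha> b" and \<alpha>: "\<alpha> > 1"
    and X: "X \<in> tail_space M b" and Y: "Y \<in> tail_space M b"
    and Z: "(\<lambda>\<omega>. X \<omega> + Y \<omega>) \<in> tail_space M b"
  shows "tail_norm M \<alpha> b (\<lambda>\<omega>. X \<omega> + Y \<omega>) \<le> tail_norm M \<alpha> b X + tail_norm M \<alpha> b Y"
proof (rule field_le_epsilon)
  fix e :: real assume e: "e > 0"
  let ?Z = "\<lambda>\<omega>. X \<omega> + Y \<omega>"
  \<comment> \<open>The optimal weight \<open>\<parallel>X\<parallel> / (\<parallel>X\<parallel> + \<parallel>Y\<parallel>)\<close> may be \<open>0\<close>, \<open>1\<close> or undefined, hence the perturbation.\<close>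
  define x where "x = tail_norm M \<alpha> b X + e / 2"
  define y where "y = tail_norm M \<alpha> b Y + e / 2"
  have xy: "x > 0" "y > 0"
    using e by (auto simp: x_def y_def tail_norm_def intro!: add_nonneg_pos)
  have scale_le: "tail_scale M b W \<le> (tail_norm M \<alpha> b W + e / 2) powr \<alpha>"
    if "W \<in> tail_space M b" for W
  proof -
    have "tail_scale M b W = tail_norm M \<alpha> b W powr \<alpha>"
      using tail_scale_nonneg[OF M b that] \<alpha> by (simp add: tail_norm_def powr_powr)
    also have "\<dots> \<le> (tail_norm M \<alpha> b W + e / 2) powr \<alpha>"
      using e \<alpha> by (intro powr_mono2) (auto simp: tail_norm_def)
    finally show ?thesis .
  qed
  \<comment> \<open>For the weights \<open>p = x / (x + y)\<close> and
    \<open>q = y / (x + y)\<close> both summands share the factor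
    \<open>(x + y) powr (\<alpha> - 1)\<close>, so the bound collapses to
    \<open>(x + y) powr \<alpha>\<close>.\<close>
  have weight: "v powr \<alpha> * (v / (x + y)) powr (1 - \<alpha>) = v * (x + y) powr (\<alpha> - 1)"
    if "v > 0" for v
  proof -
    have "(v / (x + y)) powr (1 - \<alpha>) = v powr (1 - \<alpha>) * (x + y) powr (\<alpha> - 1)"
      using xy that powr_minus_divide[of "x + y" "1 - \<alpha>"] by (simp add: powr_divide)
    moreover have "v powr \<alpha> * v powr (1 - \<alpha>) = v"
      using that by (simp flip: powr_add)
    ultimately show ?thesis by (metis mult.assoc)
  qed
  have "tail_scale M b ?Z \<le> tail_scale M b X * (x / (x + y)) powr (1 - \<alpha>) +
      tail_scale M b Y * (y / (x + y)) powr (1 - \<alpha>)"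
    using xy by (intro tail_scale_add_le[OF M b \<alpha> X Y Z]) (auto simp: add_pos_pos simp flip: add_divide_distrib)
  also have "\<dots> \<le> x powr \<alpha> * (x / (x + y)) powr (1 - \<alpha>) + y powr \<alpha> * (y / (x + y)) powr (1 - \<alpha>)"
    using scale_le[OF X] scale_le[OF Y] unfolding x_def[symmetric] y_def[symmetric]
    by (intro add_mono mult_right_mono) auto
  also have "\<dots> = (x + y) powr 1 * (x + y) powr (\<alpha> - 1)"
    using xy by (simp add: weight distrib_right)
  also have "\<dots> = (x + y) powr \<alpha>"
    by (subst powr_add[symmetric]) simp
  finally have "tail_norm M \<alpha> b ?Z \<le> ((x + y) powr \<alpha>) powr (1 / \<alpha>)"
    unfolding tail_norm_def using tail_scale_nonneg[OF M b Z] \<alpha> by (intro powr_mono2) auto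
  also have "\<dots> = x + y" using xy \<alpha> by (simp add: powr_powr)
  finally show "tail_norm M \<alpha> b ?Z \<le> tail_norm M \<alpha> b X + tail_norm M \<alpha> b Y + e"
    by (simp add: x_def y_def)
qed

section \<open>Homogeneity and conclusion\<close>

lemma tail_norm_scale:
  assumes "prob_space M" "normalizing_function \<alpha> b" "X \<in> tail_space M b"
  shows "tail_norm M \<alpha> b (\<lambda>\<omega>. c * X \<omega>) = \<bar>c\<bar> * tail_norm M \<alpha> b X"
proof (cases "c = 0")
  case True
  \<comment> \<open>Here the convention \<open>0 powr (1 / \<alpha>) = 0\<close> enters.\<close>
  then show ?thesis by (simp add: tail_norm_def tail_scale_zero)
next
  case False
  have "\<alpha> > 0" using assms(2) by (simp add: normalizing_function_def)
  then show ?thesis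
    using tail_scale_nonneg[OF assms] False
    by (simp add: tail_norm_def tail_scale_scale[OF assms False] powr_mult powr_powr)
qed

theorem theorem2:
  fixes M :: "'a measure" and b :: "real \<Rightarrow> real" and \<alpha> :: real
  assumes "prob_space M"
    and "normalizing_function \<alpha> b"
    and "\<alpha> > 1"
  shows "seminorm_on (tail_space M b) (tail_norm M \<alpha> b)"
  unfolding seminorm_on_def
  using zero_in_tail_space scale_in_tail_space tail_norm_scale[OF assms(1,2)]
    tail_norm_triangle[OF assms]
  \<comment> \<open>Unfolding \<open>tail_norm\<close> yields nonnegativity, since every value of
    \<open>powr\<close> is nonnegative.\<close>
  by (auto simp: tail_norm_def)

end
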